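(* Let $(a_n)_{n\ge1}$, $(b_n)_{n\ge1}$ be sequences of positive integers and $\theta=\sum_{n=1}^{\infty}\frac{a_n}{b_n}$. Let $f$ be a function defined on the values $b_n$ with $f(b_n)>0$ for all $n$. Assume: (1) $b_1<b_2<\cdots$ and $b_n\mid b_{n+1}$ for all $n$; (2) $\frac{f(b_n)}{f(b_{n+1})}<\frac12$ for all sufficiently large $n$; (3) $\frac{f(b_n)}{b_{n+1}}a_{n+1}<\frac12$ for all sufficiently large $n$; (4) $\frac{b_n}{f(b_n)}\to0$ as $n\to\infty$. Then (i) $\theta$ is an irrational number; and (ii) there are infinitely many distinct fractions $\frac{c_n}{b_n}$, with $c_n$ integers, such that $\left|\theta-\frac{c_n}{b_n}\right|<\frac{1}{f(b_n)}$ (for all sufficiently large $n$). *)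

theory Defs
  imports Complex_Main
begin

end

theory Submission
  imports Defs
begin

text \<open>
  Since the denominators divide one another, the \<open>n\<close>-th partial sum is \<open>c n / b n\<close> for an integer
  \<open>c n\<close>. The two bounds by \<open>1/2\<close> make the terms telescope:
  \<open>a (n+1) / b (n+1) < 1 / f (b n) - 1 / f (b (n+1))\<close>, so the \<open>n\<close>-th tail lies strictly between
  \<open>0\<close> and \<open>1 / f (b n)\<close>. As \<open>b n / f (b n)\<close> tends to \<open>0\<close>, these approximations are too good for a
  rational \<open>\<theta>\<close>; and the partial sums are distinct because the terms are positive.
\<close>

lemma less_diff_inverses_if_halves:
  fixes s x y :: "'a::linordered_field"
  assumes "x > 0" and "x / y < 1 / 2" and "x * s < 1 / 2"
  shows "s < 1 / x - 1 / y"
proof -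
  have "x * (s + 1 / y) = x * s + x / y"
    by (simp add: distrib_left)
  also have "\<dots> < 1 / 2 + 1 / 2"
    using assms(3,2) by (rule add_strict_mono)
  finally have "s + 1 / y < 1 / x"
    using \<open>x > 0\<close> by (simp add: pos_less_divide_eq mult.commute)
  then show ?thesis
    by (simp add: less_diff_eq)
qed

lemma sum_le_if_telescoping:
  fixes t u :: "nat \<Rightarrow> 'a::ordered_ab_group_add"
  assumes "\<And>k. k \<ge> n \<Longrightarrow> t k \<le> u k - u (Suc k)"
  shows "(\<Sum>k<m. t (k + n)) \<le> u n - u (m + n)"
proof -
  have "(\<Sum>k<m. t (k + n)) \<le> (\<Sum>k<m. u (k + n) - u (Suc k + n))"
    using assms by (intro sum_mono) simp
  also have "\<dots> = u n - u (m + n)"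
    using sum_lessThan_telescope'[of "\<lambda>k. u (k + n)" m] by simp
  finally show ?thesis .
qed

lemma summable_if_telescoping:
  fixes t u :: "nat \<Rightarrow> real"
  assumes "\<forall>\<^sub>F n in sequentially. 0 \<le> t n"
    and "\<forall>\<^sub>F n in sequentially. 0 \<le> u n"
    and "\<forall>\<^sub>F n in sequentially. t n \<le> u n - u (Suc n)"
  shows "summable t"
proof -
  obtain N where t_nonneg: "\<And>n. n \<ge> N \<Longrightarrow> 0 \<le> t n" and u_nonneg: "\<And>n. n \<ge> N \<Longrightarrow> 0 \<le> u n"
    and telescoping: "\<And>n. n \<ge> N \<Longrightarrow> t n \<le> u n - u (Suc n)"
    using eventually_conj[OF assms(1) eventually_conj[OF assms(2,3)]]
    unfolding eventually_sequentially by blast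
  have "(\<Sum>k\<le>m. t (k + N)) \<le> u N" for m
    using sum_le_if_telescoping[of N t u "Suc m", OF telescoping] u_nonneg[of "Suc m + N"]
    unfolding lessThan_Suc_atMost by simp
  then have "summable (\<lambda>k. t (k + N))"
    using t_nonneg by (intro bounded_imp_summable) simp_all
  then show ?thesis
    by (simp only: summable_iff_shift)
qed

lemma suminf_tail_le_if_telescoping:
  fixes t u :: "nat \<Rightarrow> real"
  assumes "summable t"
    and telescoping: "\<And>k. k \<ge> n \<Longrightarrow> t k \<le> u k - u (Suc k)"
    and u_nonneg: "\<And>k. k \<ge> n \<Longrightarrow> 0 \<le> u k"
  shows "suminf t - (\<Sum>k<n. t k) \<le> u n"
proof -
  have "(\<Sum>k<m. t (k + n)) \<le> u n" for m
    using sum_le_if_telescoping[of n t u m, OF telescoping] u_nonneg[of "m + n"] by simp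
  then have "(\<Sum>k. t (k + n)) \<le> u n"
    using \<open>summable t\<close> by (intro suminf_le_const) (simp_all only: summable_iff_shift)
  then show ?thesis
    by (simp add: suminf_minus_initial_segment \<open>summable t\<close>)
qed

lemma suminf_tail_bounds_if_telescoping:
  fixes t u :: "nat \<Rightarrow> real"
  assumes t_pos: "\<forall>\<^sub>F n in sequentially. 0 < t n"
    and u_nonneg: "\<forall>\<^sub>F n in sequentially. 0 \<le> u n"
    and telescoping: "\<forall>\<^sub>F n in sequentially. t n < u n - u (Suc n)"
  shows "\<forall>\<^sub>F n in sequentially.
    0 < suminf t - (\<Sum>k<n. t k) \<and> suminf t - (\<Sum>k<n. t k) < u n"
proof -
  have "summable t"
    using t_pos u_nonneg telescoping
    by (intro summable_if_telescoping[of t u]) (auto elim: eventually_mono)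
  obtain N where N: "\<And>n. n \<ge> N \<Longrightarrow> 0 < t n \<and> 0 \<le> u n \<and> t n < u n - u (Suc n)"
    using eventually_conj[OF t_pos eventually_conj[OF u_nonneg telescoping]]
    unfolding eventually_sequentially by blast
  have "0 < suminf t - (\<Sum>k<n. t k)" if "n \<ge> N" for n
    using sum_less_suminf[OF \<open>summable t\<close>, of n] N that by simp
  moreover have "suminf t - (\<Sum>k<n. t k) < u n" if "n \<ge> N" for n
  proof -
    have "suminf t - (\<Sum>k<Suc n. t k) \<le> u (Suc n)"
      using N that by (intro suminf_tail_le_if_telescoping \<open>summable t\<close>) (simp_all add: less_imp_le)
    then show ?thesis
      using N[OF that] by simp
  qed
  ultimately show ?thesis
    unfolding eventually_sequentially by blast
qed

lemma suminf_tail_bounds_if_halves: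
  fixes t g :: "nat \<Rightarrow> real"
  assumes t_pos: "\<forall>\<^sub>F n in sequentially. 0 < t n"
    and g_pos: "\<forall>\<^sub>F n in sequentially. 0 < g n"
    and ratio: "\<forall>\<^sub>F n in sequentially. g n / g (Suc n) < 1 / 2"
    and bound: "\<forall>\<^sub>F n in sequentially. g n * t n < 1 / 2"
  shows "\<forall>\<^sub>F n in sequentially.
    0 < suminf t - (\<Sum>k<n. t k) \<and> suminf t - (\<Sum>k<n. t k) < 1 / g n"
proof (rule suminf_tail_bounds_if_telescoping[OF t_pos])
  show "\<forall>\<^sub>F n in sequentially. 0 \<le> 1 / g n"
    using g_pos by eventually_elim simp
  show "\<forall>\<^sub>F n in sequentially. t n < 1 / g n - 1 / g (Suc n)"
    using g_pos ratio bound by eventually_elim (rule less_diff_inverses_if_halves)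
qed

lemma sum_fractions_common_denominator:
  fixes a b :: "'i \<Rightarrow> int" and q :: int
  assumes "\<And>i. i \<in> I \<Longrightarrow> b i dvd q" and "q \<noteq> 0"
  shows "(\<Sum>i\<in>I. of_int (a i) / of_int (b i) :: 'a::field_char_0)
    = of_int (\<Sum>i\<in>I. a i * (q div b i)) / of_int q"
  using assms by (simp add: sum_divide_distrib of_int_div)

lemma sum_fractions_dvd_chain:
  fixes a b :: "nat \<Rightarrow> int"
  assumes b_dvd: "\<And>n. n \<ge> m \<Longrightarrow> b n dvd b (Suc n)"
    and b_nonzero: "\<And>n. n \<ge> m \<Longrightarrow> b n \<noteq> 0"
  obtains c :: "nat \<Rightarrow> int"
  where "\<And>n. n \<ge> m \<Longrightarrow>
    (\<Sum>k=m..n. of_int (a k) / of_int (b k) :: 'a::field_char_0) = of_int (c n) / of_int (b n)"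
proof
  fix n assume "n \<ge> m"
  have "b k dvd b n" if "k \<in> {m..n}" for k
  proof -
    have "k \<le> n" "m \<le> k"
      using that by simp_all
    then show ?thesis
      by (induction rule: dec_induct) (auto intro: dvd_trans[OF _ b_dvd])
  qed
  then show "(\<Sum>k=m..n. of_int (a k) / of_int (b k) :: 'a)
      = of_int (\<Sum>k=m..n. a k * (b n div b k)) / of_int (b n)"
    by (intro sum_fractions_common_denominator b_nonzero \<open>n \<ge> m\<close>)
qed

lemma dist_distinct_fractions_ge:
  fixes m k p q :: int
  assumes "k \<noteq> 0" and "q \<noteq> 0"
    and "of_int m / of_int k \<noteq> (of_int p / of_int q :: 'a::linordered_field)"
  shows "1 / (\<bar>of_int k\<bar> * \<bar>of_int q\<bar>) \<le> \<bar>of_int m / of_int k - of_int p / of_int q :: 'a\<bar>"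
proof -
  define z where "z = m * q - p * k"
  have diff: "of_int m / of_int k - of_int p / of_int q = (of_int z / of_int (k * q) :: 'a)"
    using assms(1,2) by (simp add: z_def diff_frac_eq)
  then have "z \<noteq> 0"
    using assms(3) by force
  then have "(of_int 1 :: 'a) \<le> of_int \<bar>z\<bar>"
    by (simp only: of_int_le_iff)
  then show ?thesis
    unfolding diff by (simp add: abs_mult divide_right_mono)
qed

lemma irrational_if_good_approximations:
  fixes \<theta> :: real and p q :: "'a \<Rightarrow> int" and \<epsilon> :: "'a \<Rightarrow> real"
  assumes nonzero: "\<forall>\<^sub>F x in F. q x \<noteq> 0"
    and distinct: "\<exists>\<^sub>F x in F. \<theta> \<noteq> of_int (p x) / of_int (q x)"
    and approx: "\<forall>\<^sub>F x in F. \<bar>\<theta> - of_int (p x) / of_int (q x)\<bar> \<le> \<epsilon> x"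
    and lim: "((\<lambda>x. of_int (q x) * \<epsilon> x) \<longlongrightarrow> 0) F"
  shows "\<theta> \<notin> \<rat>"
proof
  assume "\<theta> \<in> \<rat>"
  then obtain m k :: int where "k > 0" and \<theta>: "\<theta> = of_int m / of_int k"
    by (metis Rats_cases')
  have "\<forall>\<^sub>F x in F. \<bar>of_int (q x) * \<epsilon> x\<bar> < 1 / of_int k"
    using tendstoD[OF lim, of "1 / of_int k"] \<open>k > 0\<close> by simp
  with nonzero approx have "\<forall>\<^sub>F x in F. \<theta> = of_int (p x) / of_int (q x)"
  proof eventually_elim
    case (elim x)
    show ?case
    proof (rule ccontr)
      assume "\<theta> \<noteq> of_int (p x) / of_int (q x)"
      then have "1 / (of_int k * \<bar>of_int (q x)\<bar>) \<le> \<bar>\<theta> - of_int (p x) / of_int (q x)\<bar>"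
        using dist_distinct_fractions_ge[of k "q x" m "p x", where ?'a = real] elim(1) \<open>k > 0\<close>
        unfolding \<theta> by simp
      also have "\<dots> \<le> \<epsilon> x"
        by (rule elim(2))
      finally have "1 / of_int k \<le> \<bar>of_int (q x)\<bar> * \<epsilon> x"
        using elim(1) \<open>k > 0\<close> by (simp add: field_simps)
      also have "\<dots> \<le> \<bar>of_int (q x) * \<epsilon> x\<bar>"
        by (simp add: abs_mult mult_left_mono)
      finally show False
        using elim(3) by simp
    qed
  qed
  then show False
    using distinct by (simp add: frequently_def)
qed

lemma infinite_values_if_eventually:
  fixes f :: "nat \<Rightarrow> 'a"
  assumes "inj_on f {n. P n}" and "\<forall>\<^sub>F n in sequentially. P n"
  shows "infinite {f n | n. P n}"
proof -
  have "infinite {n. P n}"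
    using eventually_frequently[OF sequentially_bot assms(2)]
    by (simp add: frequently_cofinite flip: cofinite_eq_sequentially)
  then have "infinite (f ` {n. P n})"
    using assms(1) by (simp add: finite_image_iff)
  then show ?thesis
    by (simp add: setcompr_eq_image)
qed

theorem theorem6:
  fixes a b :: "nat \<Rightarrow> nat" and f :: "nat \<Rightarrow> real" and \<theta> :: real
  assumes a_pos: "\<And>n. n \<ge> 1 \<Longrightarrow> a n > 0"
    and b_pos: "\<And>n. n \<ge> 1 \<Longrightarrow> b n > 0"
    and theta: "\<theta> = (\<Sum>n. real (a (Suc n)) / real (b (Suc n)))"
    and f_pos: "\<And>n. n \<ge> 1 \<Longrightarrow> f (b n) > 0"
    and b_less: "\<And>n. n \<ge> 1 \<Longrightarrow> b n < b (Suc n)"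
    and b_dvd: "\<And>n. n \<ge> 1 \<Longrightarrow> b n dvd b (Suc n)"
    and f_ratio: "\<forall>\<^sub>F n in sequentially. f (b n) / f (b (Suc n)) < 1 / 2"
    and a_bound: "\<forall>\<^sub>F n in sequentially. f (b n) / real (b (Suc n)) * real (a (Suc n)) < 1 / 2"
    and lim: "(\<lambda>n. real (b n) / f (b n)) \<longlonglongrightarrow> 0"
  shows "\<theta> \<notin> \<rat> \<and>
    (\<exists>c :: nat \<Rightarrow> int.
       (\<forall>\<^sub>F n in sequentially. \<bar>\<theta> - of_int (c n) / real (b n)\<bar> < 1 / f (b n)) \<and>
       infinite {of_int (c n) / real (b n) | n.
         n \<ge> 1 \<and> \<bar>\<theta> - of_int (c n) / real (b n)\<bar> < 1 / f (b n)})"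
proof -
  define t where "t k = real (a (Suc k)) / real (b (Suc k))" for k
  note ge_1 = eventually_ge_at_top[of "1::nat"]
  have t_pos: "0 < t k" for k
    using a_pos b_pos by (simp add: t_def)
  have tail: "\<forall>\<^sub>F n in sequentially. 0 < \<theta> - (\<Sum>k<n. t k) \<and> \<theta> - (\<Sum>k<n. t k) < 1 / f (b n)"
    unfolding theta t_def[symmetric] using t_pos f_ratio a_bound eventually_mono[OF ge_1 f_pos]
    by (intro suminf_tail_bounds_if_halves) (simp_all add: t_def)
  obtain c :: "nat \<Rightarrow> int" where c: "\<And>n. n \<ge> 1 \<Longrightarrow> (\<Sum>k<n. t k) = of_int (c n) / real (b n)"
    using sum_fractions_dvd_chain[of 1 "\<lambda>n. int (b n)" "\<lambda>n. int (a n)", where ?'a = real]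
      b_dvd b_pos by (force simp: t_def sum.atLeast1_atMost_eq)
  have approx: "\<forall>\<^sub>F n in sequentially. n \<ge> 1 \<and> \<theta> \<noteq> of_int (c n) / real (b n) \<and>
      \<bar>\<theta> - of_int (c n) / real (b n)\<bar> < 1 / f (b n)"
    using ge_1 tail by eventually_elim (auto simp: c)
  then have "\<theta> \<notin> \<rat>"
    using lim b_pos
    by (intro irrational_if_good_approximations[where F = sequentially and p = c and
          q = "\<lambda>n. int (b n)" and \<epsilon> = "\<lambda>n. 1 / f (b n)"])
       (auto elim: eventually_mono intro!: eventually_frequently)
  moreover have "inj (\<lambda>n. \<Sum>k<n. t k)"
    using t_pos by (intro strict_mono_imp_inj_on) (simp add: strict_mono_Suc_iff)
  then have "infinite {of_int (c n) / real (b n) | n.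
      n \<ge> 1 \<and> \<bar>\<theta> - of_int (c n) / real (b n)\<bar> < 1 / f (b n)}"
    using approx by (intro infinite_values_if_eventually)
      (auto simp: inj_on_def simp flip: c elim: eventually_mono)
  ultimately show ?thesis
    using approx by (intro conjI exI[of _ c]) (auto elim: eventually_mono)
qed

end
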